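(* Let $\mathbf{U}=[u_{i,j}]_{i,j=1}^{N}\in\mathbb{R}^{N\times N}$ be a symmetric matrix with nonnegative entries and spectral radius $\rho(\mathbf{U})<1$. Let $m\ge 1$ be an integer, let $p_{\mathrm{term}}\in(0,1)$, and let $\mathrm{sample}$ be a sampling strategy on the weighted graph $\mathrm{G}_{\mathbf{U}}$ which is not degenerate, i.e. whenever it is called at a vertex $v$ (with any history) it assigns a positive probability to every neighbor $w$ of $v$. Let $\mathbf{B}\in\mathbb{R}^{N\times N}$ be the random matrix whose $i$-th row is $\phi(i)^{\top}$ for $i=1,\dots,N$, where $\phi(i)\in\mathbb{R}^{N}$ is the signature vector of node $i$ computed by the random-walk procedure described in the context, and let $\mathbf{B}'$ be an independent copy of $\mathbf{B}$. Then $$(\mathbf{I}_{N}-\mathbf{U})^{-2}=\mathbb{E}\left[\mathbf{B}(\mathbf{B}')^{\top}\right].$$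
   Context: $\mathrm{G}_{\mathbf{U}}$ is the weighted graph on vertex set $\{1,\dots,N\}$ with weighted adjacency matrix $\mathbf{U}$: the neighbors of $v$ are the $w$ with $u_{v,w}>0$ (loops are allowed), and $u_{v,w}$ is the weight of the edge $(v,w)$. Sampling strategy: $\mathrm{sample}(v,\mathrm{G}_{\mathbf{U}},\mathcal{H})$ takes the current vertex $v$, the graph, and a history $\mathcal{H}$ (some function of the list of edges traversed so far during the current run of the procedure, over all its walks). Conditionally on everything that has happened before, it draws a random neighbor $w$ of $v$ from a probability distribution on the neighbors of $v$ determined by $v$, $\mathrm{G}_{\mathbf{U}}$ and $\mathcal{H}$, and returns $w$ together with the probability $p$ with which this $w$ was drawn. Procedure computing the signature vector $\phi(i)$, for a fixed node $i$: 1. Set $\phi(i)[j]=0$ for $j=1,\dots,N$, and $\mathcal{H}=\emptyset$. 2. For $t=1,\dots,m$ (the $t$-th random walk): set $\mathrm{load}=1$, set the current vertex to $i$, and add $1$ to $\phi(i)[i]$. Then repeat the following until the walk terminates. Before each transition, the walk terminates with probability $p_{\mathrm{term}}$, independently of everything else (it also terminates if the current vertex has no neighbors). If it does not terminate, let $v$ be the current vertex; obtain $(w,p)=\mathrm{sample}(v,\mathrm{G}_{\mathbf{U}},\mathcal{H})$; move to $w$; replace $\mathrm{load}$ by $\mathrm{load}\cdot\dfrac{u_{v,w}}{p\,(1-p_{\mathrm{term}})}$; add the new $\mathrm{load}$ to $\phi(i)[w]$; add the edge $(v,w)$ to $\mathcal{H}$. 3. Replace $\phi(i)$ by $\phi(i)/m$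 and return it. The computations of $\phi(i)$ for different $i$ are carried out independently. $\mathbf{I}_N$ is the identity matrix. *)

theory Defs
  imports "HOL-Probability.Probability"
    "Jordan_Normal_Form.Spectral_Radius" "Jordan_Normal_Form.Gauss_Jordan_Elimination"
begin

text \<open>Nodes are numbered from \<open>0\<close>: an \<open>N \<times> N\<close> weight matrix \<open>U\<close> describes a weighted graph on
  \<open>{0..<N}\<close>.\<close>

definition neighbors :: "real mat \<Rightarrow> nat \<Rightarrow> nat set" where
  "neighbors U v = {w. w < dim_col U \<and> U $$ (v, w) > 0}"

definition edges :: "real mat \<Rightarrow> (nat \<times> nat) set" where
  "edges U = {(v, w). v < dim_row U \<and> w \<in> neighbors U v}"

text \<open>The history seen by the sampler is \<open>hist es\<close>, an arbitrary function of the list \<open>es\<close> of edges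
  traversed so far (oldest first). A strategy maps the current vertex and the history to the law of
  the next vertex; it is never called at a vertex without neighbors, so nothing is required there.
  The graph is fixed, so it is not an argument of the strategy.\<close>

definition sampling_strategy ::
  "real mat \<Rightarrow> ((nat \<times> nat) list \<Rightarrow> 'h) \<Rightarrow> (nat \<Rightarrow> 'h \<Rightarrow> nat pmf) \<Rightarrow> bool" where
  "sampling_strategy U hist sample \<longleftrightarrow>
     (\<forall>v < dim_row U. \<forall>es \<in> lists (edges U). neighbors U v \<noteq> {} \<longrightarrow>
        set_pmf (sample v (hist es)) \<subseteq> neighbors U v)"

definition nondegenerate ::
  "real mat \<Rightarrow> ((nat \<times> nat) list \<Rightarrow> 'h) \<Rightarrow> (nat \<Rightarrow> 'h \<Rightarrow> nat pmf) \<Rightarrow> bool" where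
  "nondegenerate U hist sample \<longleftrightarrow>
     (\<forall>v < dim_row U. \<forall>es \<in> lists (edges U). \<forall>w \<in> neighbors U v.
        pmf (sample v (hist es)) w > 0)"

text \<open>One random walk, from its current vertex \<open>v\<close> on. The arguments \<open>load\<close>, \<open>\<phi>\<close>, \<open>es\<close> are the
  current load, the unnormalized signature vector and the list of edges traversed so far; the result
  is the final value of the last two. The missing mass of the \<open>spmf\<close> is the probability that the
  walk never terminates.\<close>

partial_function (spmf) walk ::
  "real mat \<Rightarrow> real \<Rightarrow> ((nat \<times> nat) list \<Rightarrow> 'h) \<Rightarrow> (nat \<Rightarrow> 'h \<Rightarrow> nat pmf) \<Rightarrow>
   nat \<Rightarrow> real \<Rightarrow> (nat \<Rightarrow> real) \<Rightarrow> (nat \<times> nat) list \<Rightarrow>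
   ((nat \<Rightarrow> real) \<times> (nat \<times> nat) list) spmf" where
  "walk U p_term hist sample v load \<phi> es =
     bind_pmf (bernoulli_pmf p_term) (\<lambda>stop.
       if stop \<or> neighbors U v = {} then return_spmf (\<phi>, es)
       else bind_pmf (sample v (hist es)) (\<lambda>w.
         let p = pmf (sample v (hist es)) w;
             load' = load * (U $$ (v, w) / (p * (1 - p_term)))
         in walk U p_term hist sample w load' (\<phi>(w := \<phi> w + load')) (es @ [(v, w)])))"

primrec walks ::
  "real mat \<Rightarrow> real \<Rightarrow> ((nat \<times> nat) list \<Rightarrow> 'h) \<Rightarrow> (nat \<Rightarrow> 'h \<Rightarrow> nat pmf) \<Rightarrow>
   nat \<Rightarrow> nat \<Rightarrow> ((nat \<Rightarrow> real) \<times> (nat \<times> nat) list) spmf" where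
  "walks U p_term hist sample i 0 = return_spmf (\<lambda>_. 0, [])"
| "walks U p_term hist sample i (Suc t) =
     bind_spmf (walks U p_term hist sample i t) (\<lambda>(\<phi>, es).
       walk U p_term hist sample i 1 (\<phi>(i := \<phi> i + 1)) es)"

definition signature ::
  "real mat \<Rightarrow> real \<Rightarrow> ((nat \<times> nat) list \<Rightarrow> 'h) \<Rightarrow> (nat \<Rightarrow> 'h \<Rightarrow> nat pmf) \<Rightarrow>
   nat \<Rightarrow> nat \<Rightarrow> (nat \<Rightarrow> real) spmf" where
  "signature U p_term hist sample m i =
     map_spmf (\<lambda>(\<phi>, es) j. \<phi> j / real m) (walks U p_term hist sample i m)"

text \<open>The rows of the random matrix are independent runs of the procedure, one for each node. As
  \<open>'a spmf\<close> abbreviates \<open>'a option pmf\<close>, a row is \<open>None\<close> exactly when its run does not terminate;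
  \<open>the\<close> is meaningful because the runs terminate almost surely.\<close>

definition signature_matrix ::
  "real mat \<Rightarrow> real \<Rightarrow> ((nat \<times> nat) list \<Rightarrow> 'h) \<Rightarrow> (nat \<Rightarrow> 'h \<Rightarrow> nat pmf) \<Rightarrow>
   nat \<Rightarrow> real mat pmf" where
  "signature_matrix U p_term hist sample m =
     map_pmf (\<lambda>\<phi>. mat (dim_row U) (dim_row U) (\<lambda>(i, j). the (\<phi> i) j))
       (Pi_pmf {..<dim_row U} None (\<lambda>i. signature U p_term hist sample m i))"

end

theory Submission
  imports Defs
begin

text \<open>Let \<open>V = (I - U)^-1\<close>. Dividing by the sampling probability and by \<open>1 - p_term\<close> makes every
  step unbiased whatever the history is: a walk at \<open>v\<close> with load \<open>l\<close> and signature \<open>\<phi>\<close> ends with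
  expected \<open>j\<close>-th entry \<open>\<phi> j + l * (U V)(v, j)\<close>. The upper bound is fixpoint induction on the walk;
  the lower bound is induction on the length of the partial sums of the Neumann series, started by
  the fact that the walk terminates almost surely and never decreases \<open>\<phi>\<close>. Hence the entries of
  the signature matrix have expectation \<open>V\<close>, and independence together with the symmetry of \<open>V\<close>
  gives \<open>V V^T = V^2\<close>.\<close>

section \<open>Nonnegative expectations over subprobability mass functions\<close>

text \<open>The missing mass counts as 0, so the value grows along the approximation order of
  \<open>spmf\<close>. Integrating over the underlying \<open>pmf\<close> of options lets the
  monadic binds of the procedure unfold directly, and values in \<open>ennreal\<close> postpone all
  questions of integrability.\<close>

definition nn_expectation :: "'a spmf \<Rightarrow> ('a \<Rightarrow> ennreal) \<Rightarrow> ennreal" where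
  "nn_expectation p f = (\<integral>\<^sup>+ x. case_option 0 f x \<partial>measure_pmf p)"

lemma nn_expectation_measure_spmf: "nn_expectation p f = nn_integral (measure_spmf p) f"
proof -
  have "nn_integral (measure_spmf p) f
      = (\<integral>\<^sup>+ x. f (the x) * indicator (range Some) x \<partial>measure_pmf p)"
    by (simp add: nn_integral_measure_spmf_conv_measure_pmf nn_integral_restrict_space)
  also have "\<dots> = nn_expectation p f"
    unfolding nn_expectation_def
    by (intro nn_integral_cong) (auto split: option.split simp: indicator_def)
  finally show ?thesis ..
qed

lemma nn_expectation_return_spmf [simp]: "nn_expectation (return_spmf x) f = f x"
  by (simp add: nn_expectation_def)

lemma nn_expectation_return_None [simp]: "nn_expectation (return_pmf None) f = 0"
  by (simp add: nn_expectation_def)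

lemma nn_expectation_bind_pmf:
  "nn_expectation (bind_pmf p g) f = (\<integral>\<^sup>+ x. nn_expectation (g x) f \<partial>measure_pmf p)"
  by (simp add: nn_expectation_def)

lemma nn_expectation_bind_spmf:
  "nn_expectation (bind_spmf p g) f = nn_expectation p (\<lambda>x. nn_expectation (g x) f)"
  unfolding nn_expectation_def bind_spmf_def nn_integral_bind_pmf
  by (intro nn_integral_cong) (auto split: option.split)

lemma nn_expectation_mono:
  assumes "\<And>x. x \<in> set_spmf p \<Longrightarrow> f x \<le> g x"
  shows "nn_expectation p f \<le> nn_expectation p g"
  unfolding nn_expectation_def
  by (intro nn_integral_mono_AE) (auto simp: AE_measure_pmf_iff in_set_spmf intro!: assms split: option.split)

lemma nn_expectation_cong:
  assumes "\<And>x. x \<in> set_spmf p \<Longrightarrow> f x = g x"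
  shows "nn_expectation p f = nn_expectation p g"
  by (intro antisym nn_expectation_mono) (simp_all add: assms)

lemma nn_expectation_const_lossless:
  assumes "lossless_spmf p"
  shows "nn_expectation p (\<lambda>_. c) = c"
  using assms by (simp add: nn_expectation_measure_spmf lossless_spmf_def measure_spmf.emeasure_eq_measure)

text \<open>This is monotone convergence along a chain that may be uncountable. It is valid because
  the integral is a sum over the support of the least upper bound, and that support is
  countable.\<close>

lemma nn_expectation_lub_spmf:
  assumes chain: "Complete_Partial_Order.chain (ord_spmf (=)) Y" and Y: "Y \<noteq> {}"
  shows "nn_expectation (lub_spmf Y) f = (SUP p\<in>Y. nn_expectation p f)"
proof -
  let ?M = "count_space (set_spmf (lub_spmf Y))"
  have "Complete_Partial_Order.chain (\<le>) ((\<lambda>p x. ennreal (spmf p x) * f x) ` Y)"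
    using chain
    by (rule chain_imageI) (auto simp: le_fun_def dest: ord_spmf_eq_leD intro!: mult_right_mono ennreal_leI)
  note chain' = this
  have "nn_expectation (lub_spmf Y) f = (\<integral>\<^sup>+ x. ennreal (spmf (lub_spmf Y) x) * f x \<partial>?M)"
    by (simp add: nn_expectation_measure_spmf nn_integral_measure_spmf')
  also have "\<dots> = (\<integral>\<^sup>+ x. (SUP p\<in>Y. ennreal (spmf p x) * f x) \<partial>?M)"
    by (simp add: ennreal_spmf_lub_spmf[OF chain Y] SUP_mult_right_ennreal)
  also have "\<dots> = (SUP p\<in>Y. \<integral>\<^sup>+ x. ennreal (spmf p x) * f x \<partial>?M)"
    using Y chain' by (rule nn_integral_monotone_convergence_SUP_countable) simp
  \<comment> \<open>Summing over the support of the least upper bound loses nothing: it contains the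
    support of every \<open>p\<close> in the chain.\<close>
  also have "\<dots> = (SUP p\<in>Y. nn_expectation p f)"
    by (auto simp: nn_expectation_measure_spmf nn_integral_measure_spmf nn_integral_count_space_indicator
        set_lub_spmf[OF chain] in_set_spmf_iff_spmf intro!: arg_cong[of _ _ Sup] image_cong nn_integral_cong
        split: split_indicator)
  finally show ?thesis .
qed

text \<open>A supremum of numbers below \<open>c\<close> stays below \<open>c\<close>. This makes
  upper bounds on expectations accessible to fixpoint induction on \<open>walk\<close>.\<close>

lemma admissible_nn_expectation_le:
  "ccpo.admissible lub_spmf (ord_spmf (=)) (\<lambda>p. nn_expectation p f \<le> c)"
  by (rule ccpo.admissibleI) (auto simp: nn_expectation_lub_spmf intro: SUP_least)

lemma admissible_nn_expectation_le_mcont [cont_intro]: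
  "mcont lub ord lub_spmf (ord_spmf (=)) g \<Longrightarrow>
    ccpo.admissible lub ord (\<lambda>x. nn_expectation (g x) f \<le> c)"
  by (rule admissible_subst[OF admissible_nn_expectation_le])

text \<open>The support of the limit of a chain is the union of the supports, so invariants of all
  possible outcomes are admissible too.\<close>

lemma admissible_ball_set_spmf:
  "ccpo.admissible lub_spmf (ord_spmf (=)) (\<lambda>p. \<forall>x\<in>set_spmf p. Q x)"
  by (rule ccpo.admissibleI) (auto simp: set_lub_spmf)

lemma admissible_ball_set_spmf_mcont [cont_intro]:
  "mcont lub ord lub_spmf (ord_spmf (=)) g \<Longrightarrow>
    ccpo.admissible lub ord (\<lambda>x. \<forall>y\<in>set_spmf (g x). Q y)"
  by (rule admissible_subst[OF admissible_ball_set_spmf])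

section \<open>Consequences of the spectral radius being below 1\<close>

text \<open>If \<open>1\<^sub>m N - U\<close> were singular, a nonzero kernel vector would be an
  eigenvector of \<open>U\<close> for the eigenvalue 1, which forces the spectral radius to be at
  least 1.\<close>

lemma mat_inverse_one_minus:
  fixes U :: "real mat"
  assumes U: "U \<in> carrier_mat N N"
    and radius: "spectral_radius (map_mat complex_of_real U) < 1"
  obtains V where "mat_inverse (1\<^sub>m N - U) = Some V" "V \<in> carrier_mat N N"
    "(1\<^sub>m N - U) * V = 1\<^sub>m N" "V * (1\<^sub>m N - U) = 1\<^sub>m N"
proof -
  let ?A = "1\<^sub>m N - U"
  have A: "?A \<in> carrier_mat N N" using U by (rule minus_carrier_mat)
  have "mat_inverse ?A \<noteq> None"
  proof
    assume "mat_inverse ?A = None"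
    then have "det ?A = 0"
      using mat_inverse(1)[OF A, of "()"] det_non_zero_imp_unit[OF A, of "()"] by blast
    then obtain x where x: "x \<in> carrier_vec N" "x \<noteq> 0\<^sub>v N" "?A *\<^sub>v x = 0\<^sub>v N"
      using det_0_iff_vec_prod_zero_field[OF A] by blast
    \<comment> \<open>The nonzero kernel vector excludes dimension 0;
      \<open>spectral_radius_mem_max\<close> needs a positive dimension.\<close>
    have "N > 0"
      using x(1,2) by (cases N) auto
    have "x - U *\<^sub>v x = 0\<^sub>v N"
      using x(3) minus_mult_distrib_mat_vec[OF one_carrier_mat U x(1)] x(1) by simp
    then have "U *\<^sub>v x = x"
      using x(1) U by (intro eq_vecI) (auto simp: vec_eq_iff)
    then have "eigenvector U x 1"
      using x U by (simp add: eigenvector_def)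
    then have "eigenvalue (map_mat complex_of_real U) (complex_of_real 1)"
      using of_real_hom.eigenvalue_hom[OF U, of 1] by (auto simp: eigenvalue_def)
    then have "1 \<in> spectrum (map_mat complex_of_real U)"
      by (simp add: spectrum_def)
    then have "1 \<le> spectral_radius (map_mat complex_of_real U)"
      using U \<open>N > 0\<close> by (intro spectral_radius_mem_max(2)) (auto intro!: image_eqI[of _ _ 1])
    with radius show False by simp
  qed
  then obtain V where V: "mat_inverse ?A = Some V" by blast
  with mat_inverse(2)[OF A V] that show thesis by blast
qed

text \<open>The bound comes from the Jordan normal form of the complexified matrix. Boundedness
  uniform in \<open>k\<close> is enough later on, because convergence of the Neumann series will
  follow from monotonicity.\<close>

lemma pow_mat_bounded:
  fixes U :: "real mat"
  assumes U: "U \<in> carrier_mat N N"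
    and radius: "spectral_radius (map_mat complex_of_real U) < 1"
  obtains c where "\<And>k i j. i < N \<Longrightarrow> j < N \<Longrightarrow> \<bar>(U ^\<^sub>m k) $$ (i, j)\<bar> \<le> c"
proof -
  have cU: "map_mat complex_of_real U \<in> carrier_mat N N" using U by simp
  from spectral_radius_jnf_norm_bound_less_1_upper_triangular[OF cU radius]
  obtain c where c: "norm_bound (map_mat complex_of_real U ^\<^sub>m k) c" for k by blast
  have "\<bar>(U ^\<^sub>m k) $$ (i, j)\<bar> \<le> c" if "i < N" "j < N" for k i j
  proof -
    have "norm ((map_mat complex_of_real (U ^\<^sub>m k)) $$ (i, j)) \<le> c"
      using c[of k] that U unfolding norm_bound_def
      by (simp flip: of_real_hom.mat_hom_pow[OF U])
    then show ?thesis using that U by simp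
  qed
  then show thesis using that by blast
qed

lemma pow_mat_Suc_left:
  fixes A :: "'a::semiring_1 mat"
  assumes A: "A \<in> carrier_mat n n"
  shows "A ^\<^sub>m Suc k = A * A ^\<^sub>m k"
proof (induction k)
  case 0
  show ?case using A by simp
next
  case (Suc k)
  have "A ^\<^sub>m Suc (Suc k) = A * A ^\<^sub>m k * A"
    using Suc.IH by simp
  also have "\<dots> = A * A ^\<^sub>m Suc k"
    using A by (simp add: assoc_mult_mat[where n\<^sub>1=n and n\<^sub>2=n and n\<^sub>3=n and n\<^sub>4=n])
  finally show ?case .
qed

section \<open>A single step of the walk\<close>

locale graph_sampling =
  fixes U :: "real mat" and N :: nat and p_term :: real
    and hist :: "(nat \<times> nat) list \<Rightarrow> 'h" and sample :: "nat \<Rightarrow> 'h \<Rightarrow> nat pmf"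
  assumes carrier_U: "U \<in> carrier_mat N N"
    and U_nonneg: "\<And>i j. i < N \<Longrightarrow> j < N \<Longrightarrow> 0 \<le> U $$ (i, j)"
    and p_term_pos: "0 < p_term" and p_term_less: "p_term < 1"
    and strategy: "sampling_strategy U hist sample"
    and nondegenerate: "nondegenerate U hist sample"
begin

definition next_load :: "nat \<Rightarrow> real \<Rightarrow> (nat \<times> nat) list \<Rightarrow> nat \<Rightarrow> real" where
  "next_load v load es w = load * (U $$ (v, w) / (pmf (sample v (hist es)) w * (1 - p_term)))"

lemma neighbors_subset: "neighbors U v \<subseteq> {..<N}"
  using carrier_U by (auto simp: neighbors_def)

lemma finite_neighbors [simp]: "finite (neighbors U v)"
  using neighbors_subset finite_subset by blast

lemma set_sample:
  assumes "v < N" "es \<in> lists (edges U)" "neighbors U v \<noteq> {}"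
  shows "set_pmf (sample v (hist es)) \<subseteq> neighbors U v"
  using strategy assms carrier_U by (auto simp: sampling_strategy_def)

lemma pmf_sample_pos:
  assumes "v < N" "es \<in> lists (edges U)" "w \<in> neighbors U v"
  shows "0 < pmf (sample v (hist es)) w"
  using nondegenerate assms carrier_U by (auto simp: nondegenerate_def)

lemma next_load_nonneg:
  assumes "w \<in> neighbors U v" "0 \<le> load"
  shows "0 \<le> next_load v load es w"
  using assms p_term_less by (auto simp: next_load_def neighbors_def intro!: mult_nonneg_nonneg divide_nonneg_nonneg)

lemma lists_edges_snoc:
  assumes "v < N" "es \<in> lists (edges U)" "w \<in> neighbors U v"
  shows "es @ [(v, w)] \<in> lists (edges U)"
  using assms carrier_U by (auto simp: edges_def)

text \<open>The continuation \<open>K\<close> is arbitrary, so the formula serves both the walk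
  itself and the approximants met in fixpoint induction.\<close>

lemma nn_expectation_step:
  "nn_expectation (bind_pmf (bernoulli_pmf p_term) (\<lambda>stop.
       if stop \<or> neighbors U v = {} then return_spmf x else bind_pmf p K)) f =
   ennreal p_term * f x + ennreal (1 - p_term) *
     (if neighbors U v = {} then f x else (\<integral>\<^sup>+ w. nn_expectation (K w) f \<partial>measure_pmf p))"
  using p_term_pos p_term_less by (simp add: nn_expectation_bind_pmf mult.commute)

lemma nn_expectation_walk:
  "nn_expectation (walk U p_term hist sample v load \<phi> es) f =
   ennreal p_term * f (\<phi>, es) + ennreal (1 - p_term) *
     (if neighbors U v = {} then f (\<phi>, es)
      else (\<integral>\<^sup>+ w. nn_expectation (walk U p_term hist sample w (next_load v load es w)
          (\<phi>(w := \<phi> w + next_load v load es w)) (es @ [(v, w)])) f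
        \<partial>measure_pmf (sample v (hist es))))"
  by (subst walk.simps) (simp add: nn_expectation_step next_load_def Let_def)

text \<open>Importance weighting cancels the sampling probabilities, so one step of the walk replaces
  the potential \<open>g\<close> by \<open>U\<close> applied to the potential plus the visit to \<open>j\<close>.\<close>

lemma step_expectation:
  assumes v: "v < N" and load: "0 \<le> load" and \<phi>: "\<And>x. 0 \<le> \<phi> x"
    and es: "es \<in> lists (edges U)" and g: "\<And>w. w < N \<Longrightarrow> 0 \<le> g w"
  shows "ennreal p_term * ennreal (\<phi> j) + ennreal (1 - p_term) *
     (if neighbors U v = {} then ennreal (\<phi> j)
      else (\<integral>\<^sup>+ w. ennreal ((\<phi>(w := \<phi> w + next_load v load es w)) j + next_load v load es w * g w)
        \<partial>measure_pmf (sample v (hist es)))) =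
     ennreal (\<phi> j + load * (\<Sum>w<N. U $$ (v, w) * ((if w = j then 1 else 0) + g w)))"
proof -
  let ?h = "\<lambda>w. (if w = j then 1 else 0) + g w"
  let ?l = "next_load v load es"
  let ?p = "pmf (sample v (hist es))"
  \<comment> \<open>Weights are nonnegative, so a vertex that is not a neighbor has weight exactly
    0, and the sum over all vertices reduces to the neighbors.\<close>
  have zero: "U $$ (v, w) = 0" if "w < N" "w \<notin> neighbors U v" for w
    using that U_nonneg[OF v that(1)] carrier_U by (auto simp: neighbors_def)
  have sum_nb: "(\<Sum>w<N. U $$ (v, w) * ?h w) = (\<Sum>w\<in>neighbors U v. U $$ (v, w) * ?h w)"
    using neighbors_subset zero by (intro sum.mono_neutral_right) auto
  show ?thesis
  proof (cases "neighbors U v = {}")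
    case True
    have "ennreal p_term * ennreal (\<phi> j) + ennreal (1 - p_term) * ennreal (\<phi> j) = ennreal (\<phi> j)"
      using \<phi> p_term_pos p_term_less
      by (simp flip: ennreal_mult ennreal_plus distrib_right)
    then show ?thesis
      by (simp only: sum_nb True) simp
  next
    case False
    \<comment> \<open>The visit to \<open>j\<close> and the potential at \<open>w\<close> both scale
      with the new load, so they merge into the single factor \<open>?h w\<close>.\<close>
    have update: "(\<phi>(w := \<phi> w + ?l w)) j + ?l w * g w = \<phi> j + ?l w * ?h w" for w
      by (auto simp: algebra_simps)
    have nonneg: "0 \<le> \<phi> j + ?l w * ?h w" if "w \<in> neighbors U v" for w
      using that g[of w] neighbors_subset \<phi>[of j] next_load_nonneg[OF that load, of es]
      by (auto intro!: add_nonneg_nonneg mult_nonneg_nonneg)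
    \<comment> \<open>Nondegeneracy makes the sampling probability nonzero, so it can be cancelled;
      the history disappears from the right-hand side.\<close>
    have cancel: "(1 - p_term) * (?l w * ?p w) = load * U $$ (v, w)" if "w \<in> neighbors U v" for w
      using pmf_sample_pos[OF v es that] p_term_less by (simp add: next_load_def field_simps)
    have "(\<integral>\<^sup>+ w. ennreal ((\<phi>(w := \<phi> w + ?l w)) j + ?l w * g w) \<partial>measure_pmf (sample v (hist es)))
        = (\<Sum>w\<in>neighbors U v. ennreal (\<phi> j + ?l w * ?h w) * ?p w)"
      unfolding update using set_sample[OF v es False]
      by (intro nn_integral_measure_pmf_support) auto
    also have "\<dots> = ennreal (\<Sum>w\<in>neighbors U v. (\<phi> j + ?l w * ?h w) * ?p w)"
      using nonneg by (subst sum_ennreal[symmetric]) (auto intro!: sum.cong simp: ennreal_mult)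
    finally have int: "(\<integral>\<^sup>+ w. ennreal ((\<phi>(w := \<phi> w + ?l w)) j + ?l w * g w)
        \<partial>measure_pmf (sample v (hist es))) = \<dots>" .
    have "(1 - p_term) * (\<Sum>w\<in>neighbors U v. (\<phi> j + ?l w * ?h w) * ?p w) =
        (1 - p_term) * \<phi> j * (\<Sum>w\<in>neighbors U v. ?p w)
        + (\<Sum>w\<in>neighbors U v. (1 - p_term) * (?l w * ?p w) * ?h w)"
      by (simp add: algebra_simps sum.distrib sum_distrib_left sum_subtractf)
    \<comment> \<open>The sampler draws only neighbors, so its probabilities on them have total mass
      1 and the old value \<open>\<phi> j\<close> is preserved.\<close>
    also have "(\<Sum>w\<in>neighbors U v. ?p w) = 1"
      using set_sample[OF v es False] by (intro sum_pmf_eq_1) auto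
    also have "(\<Sum>w\<in>neighbors U v. (1 - p_term) * (?l w * ?p w) * ?h w)
        = load * (\<Sum>w\<in>neighbors U v. U $$ (v, w) * ?h w)"
      by (simp add: cancel sum_distrib_left mult.assoc)
    finally have scaled: "(1 - p_term) * (\<Sum>w\<in>neighbors U v. (\<phi> j + ?l w * ?h w) * ?p w)
        = (1 - p_term) * \<phi> j * 1 + load * (\<Sum>w\<in>neighbors U v. U $$ (v, w) * ?h w)" .
    have real_eq: "p_term * \<phi> j + (1 - p_term) * (\<Sum>w\<in>neighbors U v. (\<phi> j + ?l w * ?h w) * ?p w)
        = \<phi> j + load * (\<Sum>w<N. U $$ (v, w) * ?h w)"
      unfolding scaled sum_nb by (simp add: algebra_simps)
    have "0 \<le> (\<Sum>w\<in>neighbors U v. (\<phi> j + ?l w * ?h w) * ?p w)"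
      using nonneg by (intro sum_nonneg mult_nonneg_nonneg) auto
    then have "ennreal p_term * ennreal (\<phi> j) + ennreal (1 - p_term) *
        ennreal (\<Sum>w\<in>neighbors U v. (\<phi> j + ?l w * ?h w) * ?p w)
        = ennreal (p_term * \<phi> j + (1 - p_term) * (\<Sum>w\<in>neighbors U v. (\<phi> j + ?l w * ?h w) * ?p w))"
      using p_term_pos p_term_less \<phi>[of j] by (simp add: ennreal_plus ennreal_mult)
    then show ?thesis
      using False by (simp only: int real_eq if_False)
  qed
qed

section \<open>Termination and invariants of one walk\<close>

text \<open>Every step stops with probability at least \<open>p_term\<close>, whatever the state.
  Unfolding the walk \<open>n\<close> times bounds the probability of nontermination by the
  \<open>n\<close>-th power of \<open>1 - p_term\<close>, which tends to 0.\<close>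

lemma lossless_walk: "lossless_spmf (walk U p_term hist sample v load \<phi> es)"
proof -
  have bound: "pmf (walk U p_term hist sample v load \<phi> es) None \<le> (1 - p_term) ^ n" for n v load \<phi> es
  proof (induction n arbitrary: v load \<phi> es)
    case 0
    show ?case by (simp add: pmf_le_1)
  next
    case (Suc n)
    have "pmf (walk U p_term hist sample v load \<phi> es) None \<le> (1 - p_term) * (1 - p_term) ^ n"
      by (subst walk.simps)
         (use p_term_pos p_term_less in \<open>auto simp: pmf_bind Let_def pmf_le_1
            intro!: mult_left_mono measure_pmf.integral_le_const Suc.IH measure_pmf.integrable_const_bound[where B=1]\<close>)
    then show ?case by simp
  qed
  have "(\<lambda>n. (1 - p_term) ^ n) \<longlonglongrightarrow> 0"
    using p_term_pos p_term_less by (intro LIMSEQ_realpow_zero) auto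
  then have "pmf (walk U p_term hist sample v load \<phi> es) None \<le> 0"
    by (rule LIMSEQ_le_const) (use bound in auto)
  then show ?thesis
    by (simp add: lossless_iff_pmf_None order_antisym)
qed

text \<open>Loads stay nonnegative, hence the signature only grows. Keeping the history among lists
  of edges is what allows the assumptions on the sampler to be applied again at every later
  step.\<close>

lemma set_walk:
  assumes "v < N" "0 \<le> load" "es \<in> lists (edges U)"
  shows "\<forall>(\<phi>', es') \<in> set_spmf (walk U p_term hist sample v load \<phi> es).
    \<phi> \<le> \<phi>' \<and> es' \<in> lists (edges U)"
  using assms
proof (induction arbitrary: v load \<phi> es rule: walk.fixp_induct)
  case 1
  show ?case by simp
next
  case 2
  show ?case by simp
next
  case (3 W)
  have step: "\<forall>(\<phi>', es') \<in> set_spmf (W U p_term hist sample w (next_load v load es w)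
      (\<phi>(w := \<phi> w + next_load v load es w)) (es @ [(v, w)])).
      \<phi> \<le> \<phi>' \<and> es' \<in> lists (edges U)" if w: "w \<in> neighbors U v" for w
  proof -
    have "\<phi> \<le> \<phi>(w := \<phi> w + next_load v load es w)"
      using next_load_nonneg[OF w 3(3)] by (simp add: le_fun_def)
    moreover have "w < N"
      using w neighbors_subset by auto
    ultimately show ?thesis
      using 3(1)[OF _ next_load_nonneg[OF w 3(3)] lists_edges_snoc[OF 3(2,4) w]]
      by (fastforce intro: order_trans)
  qed
  \<comment> \<open>The body of \<open>walk\<close> with the recursive call replaced by
    \<open>W\<close> and the load folded into \<open>next_load\<close>; the last line of the proof
    unfolds it to meet the goal.\<close>
  let ?B = "bind_pmf (bernoulli_pmf p_term) (\<lambda>stop.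
       if stop \<or> neighbors U v = {} then return_spmf (\<phi>, es)
       else bind_pmf (sample v (hist es)) (\<lambda>w.
         W U p_term hist sample w (next_load v load es w)
           (\<phi>(w := \<phi> w + next_load v load es w)) (es @ [(v, w)])))"
  have "x = (\<phi>, es) \<or> (\<exists>w\<in>neighbors U v. x \<in> set_spmf (W U p_term hist sample w (next_load v load es w)
           (\<phi>(w := \<phi> w + next_load v load es w)) (es @ [(v, w)])))" if "x \<in> set_spmf ?B" for x
    using that set_sample[OF 3(2,4)]
    by (auto simp: in_set_spmf simp del: fun_upd_apply split: if_splits)
  then have "\<forall>(\<phi>', es') \<in> set_spmf ?B. \<phi> \<le> \<phi>' \<and> es' \<in> lists (edges U)"
    using step 3(4) by blast
  then show ?case
    unfolding Let_def next_load_def .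
qed

section \<open>Expected signature after one walk\<close>

text \<open>Any nonnegative solution \<open>S\<close> of the visit equation serves as a potential:
  the induction hypothesis bounds what follows the first step, \<open>step_expectation\<close>
  averages this bound, and the equation for \<open>S\<close> returns it to the same form.\<close>

lemma nn_expectation_walk_le:
  assumes S: "\<And>w. w < N \<Longrightarrow> S w = (\<Sum>x<N. U $$ (w, x) * ((if x = j then 1 else 0) + S x))"
    and S_nonneg: "\<And>w. w < N \<Longrightarrow> 0 \<le> S w"
    and "v < N" "0 \<le> load" "\<And>x. 0 \<le> \<phi> x" "es \<in> lists (edges U)"
  shows "nn_expectation (walk U p_term hist sample v load \<phi> es) (\<lambda>(\<phi>', es'). ennreal (\<phi>' j))
    \<le> ennreal (\<phi> j + load * S v)"
  using assms(3-)
proof (induction arbitrary: v load \<phi> es rule: walk.fixp_induct)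
  case 1
  show ?case by simp
next
  case 2
  show ?case by simp
next
  case (3 W)
  let ?l = "next_load v load es"
  let ?W = "\<lambda>w. W U p_term hist sample w (?l w) (\<phi>(w := \<phi> w + ?l w)) (es @ [(v, w)])"
  have "(\<integral>\<^sup>+ w. nn_expectation (?W w) (\<lambda>(\<phi>', es'). ennreal (\<phi>' j)) \<partial>measure_pmf (sample v (hist es)))
      \<le> (\<integral>\<^sup>+ w. ennreal ((\<phi>(w := \<phi> w + ?l w)) j + ?l w * S w) \<partial>measure_pmf (sample v (hist es)))"
    if False: "neighbors U v \<noteq> {}"
  proof -
    have "nn_expectation (?W w) (\<lambda>(\<phi>', es'). ennreal (\<phi>' j))
        \<le> ennreal ((\<phi>(w := \<phi> w + ?l w)) j + ?l w * S w)"
      if "w \<in> neighbors U v" for w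
      using neighbors_subset that 3(4) next_load_nonneg[OF that 3(3), of es]
      by (intro 3(1) lists_edges_snoc[OF 3(2,5)]) (auto intro: add_nonneg_nonneg)
    then show ?thesis
      using set_sample[OF 3(2,5) False]
      by (intro nn_integral_mono_AE) (auto simp: AE_measure_pmf_iff simp del: fun_upd_apply)
  qed
  then have "ennreal p_term * ennreal (\<phi> j) + ennreal (1 - p_term) *
      (if neighbors U v = {} then ennreal (\<phi> j)
       else (\<integral>\<^sup>+ w. nn_expectation (?W w) (\<lambda>(\<phi>', es'). ennreal (\<phi>' j))
         \<partial>measure_pmf (sample v (hist es))))
    \<le> ennreal p_term * ennreal (\<phi> j) + ennreal (1 - p_term) *
      (if neighbors U v = {} then ennreal (\<phi> j)
       else (\<integral>\<^sup>+ w. ennreal ((\<phi>(w := \<phi> w + ?l w)) j + ?l w * S w)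
         \<partial>measure_pmf (sample v (hist es))))"
    by (intro add_left_mono mult_left_mono zero_le) (simp del: fun_upd_apply)
  also have "\<dots> = ennreal (\<phi> j + load * S v)"
    unfolding S[OF 3(2)] using 3(2-5) S_nonneg by (intro step_expectation) auto
  finally show ?case
    unfolding nn_expectation_step Let_def next_load_def by (simp only: prod.case)
qed

text \<open>The sum of the \<open>(v, j)\<close> entries of \<open>U^1, \<dots>, U^n\<close>.\<close>

primrec visits :: "nat \<Rightarrow> nat \<Rightarrow> nat \<Rightarrow> real" where
  "visits j 0 v = 0"
| "visits j (Suc n) v = (\<Sum>w<N. U $$ (v, w) * ((if w = j then 1 else 0) + visits j n w))"

lemma visits_nonneg: "v < N \<Longrightarrow> 0 \<le> visits j n v"
  by (induction n arbitrary: v) (auto intro!: sum_nonneg mult_nonneg_nonneg U_nonneg)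

lemma incseq_visits: "v < N \<Longrightarrow> incseq (\<lambda>n. visits j n v)"
proof (rule incseq_SucI)
  show "v < N \<Longrightarrow> visits j n v \<le> visits j (Suc n) v" for n
  proof (induction n arbitrary: v)
    case 0
    then show ?case using visits_nonneg[of v j "Suc 0"] by simp
  next
    case (Suc n)
    show ?case
      \<comment> \<open>The second equation is instantiated at \<open>v\<close>, so that the terms
        \<open>visits j (Suc n) w\<close> under the sum stay folded and the induction hypothesis
        applies to them.\<close>
      unfolding visits.simps(2)[of j "Suc n"] unfolding visits.simps(2)[of j n v]
      using Suc by (intro sum_mono mult_left_mono add_left_mono U_nonneg) auto
  qed
qed

text \<open>Fixpoint induction begins with the empty approximant, whose expectation is 0, and so
  cannot yield a lower bound. Instead the finished walk is unfolded once per term of the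
  series.\<close>

lemma nn_expectation_walk_ge:
  assumes "v < N" "0 \<le> load" "\<And>x. 0 \<le> \<phi> x" "es \<in> lists (edges U)"
  shows "ennreal (\<phi> j + load * visits j n v)
    \<le> nn_expectation (walk U p_term hist sample v load \<phi> es) (\<lambda>(\<phi>', es'). ennreal (\<phi>' j))"
  using assms
proof (induction n arbitrary: v load \<phi> es)
  case 0
  \<comment> \<open>Almost sure termination is used here: mass lost to infinite walks would lower
    the expectation of the constant.\<close>
  have "ennreal (\<phi> j) = nn_expectation (walk U p_term hist sample v load \<phi> es) (\<lambda>_. ennreal (\<phi> j))"
    by (simp add: nn_expectation_const_lossless lossless_walk)
  also have "\<dots> \<le> nn_expectation (walk U p_term hist sample v load \<phi> es) (\<lambda>(\<phi>', es'). ennreal (\<phi>' j))"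
    using set_walk[OF 0(1,2,4), of \<phi>]
    by (intro nn_expectation_mono) (auto simp: le_fun_def intro!: ennreal_leI)
  finally show ?case by simp
next
  case (Suc n)
  let ?l = "next_load v load es"
  let ?W = "\<lambda>w. walk U p_term hist sample w (?l w) (\<phi>(w := \<phi> w + ?l w)) (es @ [(v, w)])"
  have "ennreal (\<phi> j + load * visits j (Suc n) v)
      = ennreal p_term * ennreal (\<phi> j) + ennreal (1 - p_term) *
         (if neighbors U v = {} then ennreal (\<phi> j)
          else (\<integral>\<^sup>+ w. ennreal ((\<phi>(w := \<phi> w + ?l w)) j + ?l w * visits j n w)
            \<partial>measure_pmf (sample v (hist es))))"
    using Suc.prems by (subst step_expectation) (auto simp: visits_nonneg)
  also have "\<dots> \<le> ennreal p_term * ennreal (\<phi> j) + ennreal (1 - p_term) *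
         (if neighbors U v = {} then ennreal (\<phi> j)
          else (\<integral>\<^sup>+ w. nn_expectation (?W w) (\<lambda>(\<phi>', es'). ennreal (\<phi>' j))
            \<partial>measure_pmf (sample v (hist es))))"
  proof (cases "neighbors U v = {}")
    case False
    have "ennreal ((\<phi>(w := \<phi> w + ?l w)) j + ?l w * visits j n w)
        \<le> nn_expectation (?W w) (\<lambda>(\<phi>', es'). ennreal (\<phi>' j))"
      if "w \<in> neighbors U v" for w
      using neighbors_subset that Suc.prems(3) next_load_nonneg[OF that Suc.prems(2), of es]
      by (intro Suc.IH lists_edges_snoc[OF Suc.prems(1,4)]) (auto intro: add_nonneg_nonneg)
    then have "(\<integral>\<^sup>+ w. ennreal ((\<phi>(w := \<phi> w + ?l w)) j + ?l w * visits j n w)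
          \<partial>measure_pmf (sample v (hist es)))
        \<le> (\<integral>\<^sup>+ w. nn_expectation (?W w) (\<lambda>(\<phi>', es'). ennreal (\<phi>' j))
          \<partial>measure_pmf (sample v (hist es)))"
      using set_sample[OF Suc.prems(1,4) False]
      by (intro nn_integral_mono_AE) (auto simp: AE_measure_pmf_iff simp del: fun_upd_apply)
    then show ?thesis
      by (simp only: False if_False) (intro add_left_mono mult_left_mono zero_le)
  qed simp
  finally show ?case
    unfolding nn_expectation_walk[of v load \<phi> es] by (simp only: prod.case)
qed

context
  fixes j :: nat and S :: "nat \<Rightarrow> real"
  assumes visits_tendsto: "\<And>v. v < N \<Longrightarrow> (\<lambda>n. visits j n v) \<longlonglongrightarrow> S v"
begin

lemma visits_limit_nonneg: "v < N \<Longrightarrow> 0 \<le> S v"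
  by (rule LIMSEQ_le_const[OF visits_tendsto]) (auto simp: visits_nonneg)

lemma visits_limit_fixpoint:
  assumes "v < N"
  shows "S v = (\<Sum>w<N. U $$ (v, w) * ((if w = j then 1 else 0) + S w))"
proof (rule LIMSEQ_unique)
  show "(\<lambda>n. visits j (Suc n) v) \<longlonglongrightarrow> S v"
    using visits_tendsto[OF assms] by (rule LIMSEQ_Suc)
  show "(\<lambda>n. visits j (Suc n) v) \<longlonglongrightarrow> (\<Sum>w<N. U $$ (v, w) * ((if w = j then 1 else 0) + S w))"
    unfolding visits.simps by (intro tendsto_intros visits_tendsto) simp
qed

text \<open>The limit \<open>S\<close> is itself a nonnegative solution of the visit equation, so
  the upper bound holds for it, while the lower bounds for all \<open>n\<close> pass to the limit.
  That the limit exists is shown later by matrix arguments.\<close>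

lemma nn_expectation_walk_eq:
  assumes "v < N" "0 \<le> load" "\<And>x. 0 \<le> \<phi> x" "es \<in> lists (edges U)"
  shows "nn_expectation (walk U p_term hist sample v load \<phi> es) (\<lambda>(\<phi>', es'). ennreal (\<phi>' j))
    = ennreal (\<phi> j + load * S v)"
proof (rule antisym)
  show "nn_expectation (walk U p_term hist sample v load \<phi> es) (\<lambda>(\<phi>', es'). ennreal (\<phi>' j))
      \<le> ennreal (\<phi> j + load * S v)"
    using visits_limit_fixpoint visits_limit_nonneg assms by (rule nn_expectation_walk_le)
  have "(\<lambda>n. ennreal (\<phi> j + load * visits j n v)) \<longlonglongrightarrow> ennreal (\<phi> j + load * S v)"
    by (intro tendsto_ennrealI tendsto_intros visits_tendsto assms)
  then show "ennreal (\<phi> j + load * S v)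
      \<le> nn_expectation (walk U p_term hist sample v load \<phi> es) (\<lambda>(\<phi>', es'). ennreal (\<phi>' j))"
    by (rule LIMSEQ_le_const2) (intro exI allI impI nn_expectation_walk_ge assms)
qed

end

section \<open>Successive walks and the averaged signature vector\<close>

lemma lossless_walks: "lossless_spmf (walks U p_term hist sample i t)"
  by (induction t) (auto simp: lossless_walk)

text \<open>The history and the signature carry over from one walk to the next, so each walk must
  leave behind a state that meets the hypotheses of \<open>nn_expectation_walk_eq\<close>.\<close>

lemma set_walks:
  assumes "i < N"
  shows "\<forall>(\<phi>, es) \<in> set_spmf (walks U p_term hist sample i t). (\<forall>x. 0 \<le> \<phi> x) \<and> es \<in> lists (edges U)"
proof (induction t)
  case 0
  show ?case by simp
next
  case (Suc t)
  have "(\<forall>x. 0 \<le> \<phi>' x) \<and> es' \<in> lists (edges U)"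
    if "(\<phi>, es) \<in> set_spmf (walks U p_term hist sample i t)"
      and "(\<phi>', es') \<in> set_spmf (walk U p_term hist sample i 1 (\<phi>(i := \<phi> i + 1)) es)" for \<phi> es \<phi>' es'
  proof -
    have \<phi>: "0 \<le> \<phi> x" "es \<in> lists (edges U)" for x
      using Suc.IH that(1) by auto
    then have "\<phi>(i := \<phi> i + 1) \<le> \<phi>' \<and> es' \<in> lists (edges U)"
      using set_walk[OF assms, of 1 es "\<phi>(i := \<phi> i + 1)"] that(2) by auto
    moreover have "0 \<le> (\<phi>(i := \<phi> i + 1)) x" for x
      using \<phi>(1)[of i] \<phi>(1)[of x] by simp
    ultimately show ?thesis
      unfolding le_fun_def by (meson order_trans)
  qed
  then show ?case
    by (fastforce simp: set_bind_spmf)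
qed

text \<open>The walks are dependent through the shared history, yet given any past the next one adds
  the same expected amount: 1 for the start if \<open>i = j\<close>, plus \<open>S i\<close>.
  Expectations therefore add up.\<close>

lemma nn_expectation_walks:
  assumes S: "\<And>v. v < N \<Longrightarrow> (\<lambda>n. visits j n v) \<longlonglongrightarrow> S v" and i: "i < N"
  shows "nn_expectation (walks U p_term hist sample i t) (\<lambda>(\<phi>, es). ennreal (\<phi> j))
    = ennreal (real t * ((if i = j then 1 else 0) + S i))"
proof (induction t)
  case 0
  show ?case by simp
next
  case (Suc t)
  let ?c = "(if i = j then 1 else 0) + S i"
  have c: "0 \<le> ?c"
    using visits_limit_nonneg[OF S i] by simp
  have "nn_expectation (walks U p_term hist sample i (Suc t)) (\<lambda>(\<phi>, es). ennreal (\<phi> j))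
      = nn_expectation (walks U p_term hist sample i t) (\<lambda>(\<phi>, es).
          nn_expectation (walk U p_term hist sample i 1 (\<phi>(i := \<phi> i + 1)) es) (\<lambda>(\<phi>, es). ennreal (\<phi> j)))"
    by (simp add: nn_expectation_bind_spmf case_prod_unfold)
  also have "\<dots> = nn_expectation (walks U p_term hist sample i t) (\<lambda>(\<phi>, es). ennreal (\<phi> j) + ennreal ?c)"
  proof (rule nn_expectation_cong, clarify)
    fix \<phi> es assume "(\<phi>, es) \<in> set_spmf (walks U p_term hist sample i t)"
    then have \<phi>: "0 \<le> \<phi> x" "es \<in> lists (edges U)" for x
      using set_walks[OF i, of t] by auto
    have "0 \<le> (\<phi>(i := \<phi> i + 1)) x" for x
      using \<phi>(1)[of i] \<phi>(1)[of x] by simp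
    then have "nn_expectation (walk U p_term hist sample i 1 (\<phi>(i := \<phi> i + 1)) es) (\<lambda>(\<phi>, es). ennreal (\<phi> j))
        = ennreal ((\<phi>(i := \<phi> i + 1)) j + 1 * S i)"
      by (intro nn_expectation_walk_eq[OF S, where \<phi>="\<phi>(i := \<phi> i + 1)"] i \<phi>(2))
         (simp_all del: fun_upd_apply)
    also have "(\<phi>(i := \<phi> i + 1)) j + 1 * S i = \<phi> j + ?c"
      by simp
    also have "ennreal \<dots> = ennreal (\<phi> j) + ennreal ?c"
      using \<phi>(1) c by (rule ennreal_plus)
    finally show "nn_expectation (walk U p_term hist sample i 1 (\<phi>(i := \<phi> i + 1)) es) (\<lambda>(\<phi>, es). ennreal (\<phi> j))
        = ennreal (\<phi> j) + ennreal ?c" .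
  qed
  also have "\<dots> = nn_expectation (walks U p_term hist sample i t) (\<lambda>(\<phi>, es). ennreal (\<phi> j)) + ennreal ?c"
    using nn_expectation_const_lossless[OF lossless_walks, of i t "ennreal ?c"]
    by (simp add: nn_expectation_measure_spmf case_prod_unfold nn_integral_add)
  also have "\<dots> = ennreal (real (Suc t) * ?c)"
    unfolding Suc.IH using c
    by (subst ennreal_plus[symmetric])
       (simp_all only: of_nat_Suc distrib_right mult_1 mult_nonneg_nonneg of_nat_0_le_iff add.commute)
  finally show ?case .
qed

lemma lossless_signature: "lossless_spmf (signature U p_term hist sample m i)"
  by (simp add: signature_def lossless_walks)

lemma nn_integral_signature:
  assumes S: "\<And>v. v < N \<Longrightarrow> (\<lambda>n. visits j n v) \<longlonglongrightarrow> S v" and i: "i < N" and m: "1 \<le> m"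
  shows "(\<integral>\<^sup>+ \<phi>. ennreal (the \<phi> j) \<partial>measure_pmf (signature U p_term hist sample m i))
    = ennreal ((if i = j then 1 else 0) + S i)"
proof -
  let ?c = "(if i = j then 1 else 0) + S i"
  have c: "0 \<le> ?c"
    using visits_limit_nonneg[OF S i] by simp
  have "(\<integral>\<^sup>+ \<phi>. ennreal (the \<phi> j) \<partial>measure_pmf (signature U p_term hist sample m i))
      = nn_expectation (signature U p_term hist sample m i) (\<lambda>\<phi>. ennreal (\<phi> j))"
    \<comment> \<open>The integrands differ only at \<open>None\<close>, where \<open>the\<close> is
      unspecified; this outcome has probability 0.\<close>
    unfolding nn_expectation_def using lossless_signature[of m i]
    by (intro nn_integral_cong_AE)
       (auto simp: AE_measure_pmf_iff lossless_iff_set_pmf_None split: option.split)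
  also have "\<dots> = nn_expectation (walks U p_term hist sample i m)
      (\<lambda>x. ennreal (1 / real m) * (case x of (\<phi>, es) \<Rightarrow> ennreal (\<phi> j)))"
    unfolding signature_def map_spmf_conv_bind_spmf nn_expectation_bind_spmf
    by (intro nn_expectation_cong) (use set_walks[OF i, of m] m in \<open>auto simp flip: ennreal_mult\<close>)
  also have "\<dots> = ennreal (1 / real m) * ennreal (real m * ?c)"
    by (subst nn_expectation_walks[OF S i, symmetric])
       (simp_all add: nn_expectation_measure_spmf nn_integral_cmult)
  also have "\<dots> = ennreal ?c"
    using m c by (simp flip: ennreal_mult)
  finally show ?thesis .
qed

end

section \<open>The Neumann series in matrix form\<close>

lemma index_mult_mat_sum:
  fixes A B :: "'a::comm_semiring_1 mat"
  assumes "A \<in> carrier_mat nr n" "B \<in> carrier_mat n nc" "i < nr" "j < nc"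
  shows "(A * B) $$ (i, j) = (\<Sum>k<n. A $$ (i, k) * B $$ (k, j))"
  using assms by (simp add: scalar_prod_def atLeast0LessThan)

lemma minus_add_cancel_mat:
  fixes A B :: "'a::ab_group_add mat"
  assumes "A \<in> carrier_mat n m" "B \<in> carrier_mat n m"
  shows "A - B + B = A"
  using assms by (intro eq_matI) auto

lemma add_minus_cancel_mat:
  fixes A B :: "'a::ab_group_add mat"
  assumes "A \<in> carrier_mat n m" "B \<in> carrier_mat n m"
  shows "A + B - B = A"
  using assms by (intro eq_matI) auto

context graph_sampling
begin

lemma one_plus_mult_index:
  assumes "M \<in> carrier_mat N N" "v < N" "j < N"
  shows "(1\<^sub>m N + U * M) $$ (v, j) = (if v = j then 1 else 0) + (\<Sum>w<N. U $$ (v, w) * M $$ (w, j))"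
  using assms carrier_U index_mult_mat_sum[OF carrier_U assms] by (simp del: index_mult_mat(1))

lemma one_minus_mult:
  assumes "M \<in> carrier_mat N N"
  shows "(1\<^sub>m N - U) * M = M - U * M"
  using assms by (simp add: minus_mult_distrib_mat[OF one_carrier_mat carrier_U])

text \<open>The fixed point equation says that \<open>M\<close> is a right inverse of
  \<open>1\<^sub>m N - U\<close>, and a right inverse coincides with a left inverse.\<close>

lemma inverse_one_minus_unique:
  assumes V: "V \<in> carrier_mat N N" "V * (1\<^sub>m N - U) = 1\<^sub>m N"
    and M: "M \<in> carrier_mat N N" "M = 1\<^sub>m N + U * M"
  shows "M = V"
proof -
  have UM: "U * M \<in> carrier_mat N N"
    using carrier_U M(1) by simp
  have "(1\<^sub>m N - U) * M = M - U * M"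
    using M(1) by (rule one_minus_mult)
  also have "\<dots> = (1\<^sub>m N + U * M) - U * M"
    \<comment> \<open>Only the first occurrence of \<open>M\<close> may be replaced; as a rewrite
      rule the equation would loop.\<close>
    using M(2) by (rule arg_cong)
  also have "\<dots> = 1\<^sub>m N"
    using one_carrier_mat UM by (rule add_minus_cancel_mat)
  finally have right: "(1\<^sub>m N - U) * M = 1\<^sub>m N" .
  have "V = V * ((1\<^sub>m N - U) * M)"
    using V right by simp
  also have "\<dots> = V * (1\<^sub>m N - U) * M"
    using V(1) M(1) carrier_U by (intro assoc_mult_mat[symmetric]) auto
  also have "\<dots> = M"
    using V M(1) by simp
  finally show ?thesis ..
qed

text \<open>The partial sums of the Neumann series are \<open>V - U^(n+1) V\<close>, hence bounded because the powers
  of \<open>U\<close> are; being nondecreasing, they converge, and the limit is a fixed point of \<open>M \<mapsto> I + U M\<close>.\<close>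

lemma visits_tendsto_inverse:
  assumes V: "V \<in> carrier_mat N N" "(1\<^sub>m N - U) * V = 1\<^sub>m N" "V * (1\<^sub>m N - U) = 1\<^sub>m N"
    and bounded: "\<And>k i j. i < N \<Longrightarrow> j < N \<Longrightarrow> \<bar>(U ^\<^sub>m k) $$ (i, j)\<bar> \<le> c"
    and v: "v < N" and j: "j < N"
  shows "(\<lambda>n. visits j n v) \<longlonglongrightarrow> V $$ (v, j) - (if v = j then 1 else 0)"
proof -
  \<comment> \<open>By the recursion for \<open>visits\<close>, this is the partial sum of the
    powers of \<open>U\<close> with exponents from 0 to \<open>n\<close>.\<close>
  define A where "A n = mat N N (\<lambda>(v, j). (if v = j then 1 else 0) + visits j n v)" for n
  have A [simp]: "A n \<in> carrier_mat N N" for n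
    by (simp add: A_def)
  have A_Suc: "A (Suc n) = 1\<^sub>m N + U * A n" for n
  proof (rule eq_matI)
    fix v j assume "v < dim_row (1\<^sub>m N + U * A n)" "j < dim_col (1\<^sub>m N + U * A n)"
    then have vj: "v < N" "j < N"
      using carrier_U A[of n] by auto
    show "A (Suc n) $$ (v, j) = (1\<^sub>m N + U * A n) $$ (v, j)"
      using vj by (simp only: one_plus_mult_index[OF A]) (simp add: A_def)
  qed (use carrier_U A[of n] in \<open>auto simp: A_def\<close>)
  have U_pow [simp]: "U ^\<^sub>m k \<in> carrier_mat N N" for k
    using carrier_U by simp
  have UV: "U * V \<in> carrier_mat N N"
    using carrier_U V(1) by simp
  have fix_V: "1\<^sub>m N + U * V = V"
  proof -
    have "1\<^sub>m N = V - U * V"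
      using V by (simp add: one_minus_mult)
    then have "1\<^sub>m N + U * V = (V - U * V) + U * V"
      by simp
    also have "\<dots> = V"
      using V(1) UV by (rule minus_add_cancel_mat)
    finally show ?thesis .
  qed
  \<comment> \<open>The exact remainder of the series, obtained by iterating \<open>fix_V\<close>;
    no convergence is presupposed.\<close>
  have partial: "A n + U ^\<^sub>m Suc n * V = V" for n
  proof (induction n)
    case 0
    have "A 0 = 1\<^sub>m N"
      by (intro eq_matI) (auto simp: A_def)
    then show ?case
      using carrier_U fix_V by simp
  next
    case (Suc n)
    have "U ^\<^sub>m Suc (Suc n) * V = U * (U ^\<^sub>m Suc n * V)"
      unfolding pow_mat_Suc_left[OF carrier_U, of "Suc n"]
      by (rule assoc_mult_mat[OF carrier_U U_pow V(1)])
    then have "A (Suc n) + U ^\<^sub>m Suc (Suc n) * V = 1\<^sub>m N + U * A n + U * (U ^\<^sub>m Suc n * V)"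
      by (simp only: A_Suc)
    also have "\<dots> = 1\<^sub>m N + (U * A n + U * (U ^\<^sub>m Suc n * V))"
      by (rule assoc_add_mat[OF one_carrier_mat mult_carrier_mat[OF carrier_U A]
            mult_carrier_mat[OF carrier_U mult_carrier_mat[OF U_pow V(1)]]])
    also have "U * A n + U * (U ^\<^sub>m Suc n * V) = U * (A n + U ^\<^sub>m Suc n * V)"
      by (rule mult_add_distrib_mat[symmetric, OF carrier_U A mult_carrier_mat[OF U_pow V(1)]])
    finally show ?case
      by (simp only: Suc.IH fix_V)
  qed
  have conv: "convergent (\<lambda>n. visits j n v)" if "v < N" "j < N" for v j
  proof -
    have "visits j n v \<le> \<bar>V $$ (v, j)\<bar> + (\<Sum>x<N. c * \<bar>V $$ (x, j)\<bar>)" for n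
    proof -
      have "(if v = j then 1 else 0) + visits j n v + (U ^\<^sub>m Suc n * V) $$ (v, j) = V $$ (v, j)"
        using arg_cong[OF partial[of n], of "\<lambda>M. M $$ (v, j)"] that V(1) carrier_U
        by (auto simp: A_def simp del: pow_mat.simps)
      moreover have "\<bar>(U ^\<^sub>m Suc n * V) $$ (v, j)\<bar> \<le> (\<Sum>x<N. c * \<bar>V $$ (x, j)\<bar>)"
      proof -
        have "(U ^\<^sub>m Suc n * V) $$ (v, j) = (\<Sum>x<N. (U ^\<^sub>m Suc n) $$ (v, x) * V $$ (x, j))"
          using that by (rule index_mult_mat_sum[OF U_pow V(1)])
        also have "\<bar>\<dots>\<bar> \<le> (\<Sum>x<N. \<bar>(U ^\<^sub>m Suc n) $$ (v, x) * V $$ (x, j)\<bar>)"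
          by (rule sum_abs)
        also have "\<dots> \<le> (\<Sum>x<N. c * \<bar>V $$ (x, j)\<bar>)"
          unfolding abs_mult using that by (intro sum_mono mult_right_mono bounded) auto
        finally show ?thesis .
      qed
      ultimately show ?thesis
        by (auto split: if_splits)
    qed
    then have "\<bar>visits j n v\<bar> \<le> \<bar>V $$ (v, j)\<bar> + (\<Sum>x<N. c * \<bar>V $$ (x, j)\<bar>)" for n
      using visits_nonneg[OF that(1), of j n] by simp
    then have "Bseq (\<lambda>n. visits j n v)"
      by (intro BseqI') simp
    then show ?thesis
      using incseq_visits[OF that(1)] by (intro Bseq_monoseq_convergent) (auto simp: incseq_imp_monoseq)
  qed
  define L where "L j v = lim (\<lambda>n. visits j n v)" for j v
  have L: "(\<lambda>n. visits j n v) \<longlonglongrightarrow> L j v" if "v < N" "j < N" for v j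
    using conv[OF that] by (simp add: L_def convergent_LIMSEQ_iff)
  define M where "M = mat N N (\<lambda>(v, j). (if v = j then 1 else 0) + L j v)"
  have M: "M \<in> carrier_mat N N"
    by (simp add: M_def)
  have "M = 1\<^sub>m N + U * M"
  proof (rule eq_matI)
    fix v j assume "v < dim_row (1\<^sub>m N + U * M)" "j < dim_col (1\<^sub>m N + U * M)"
    then have vj: "v < N" "j < N"
      using carrier_U M by auto
    have "M $$ (v, j) = (if v = j then 1 else 0) + L j v"
      using vj by (simp add: M_def)
    also have "L j v = (\<Sum>w<N. U $$ (v, w) * ((if w = j then 1 else 0) + L j w))"
      by (rule visits_limit_fixpoint[where S="L j"]) (use L vj in auto)
    also have "\<dots> = (\<Sum>w<N. U $$ (v, w) * M $$ (w, j))"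
      using vj by (simp add: M_def)
    finally show "M $$ (v, j) = (1\<^sub>m N + U * M) $$ (v, j)"
      using vj by (simp only: one_plus_mult_index[OF M])
  qed (use carrier_U M in auto)
  then have "M = V"
    by (rule inverse_one_minus_unique[OF V(1,3) M])
  then have "L j v = V $$ (v, j) - (if v = j then 1 else 0)"
    using v j by (auto simp: M_def)
  then show ?thesis
    using L[OF v j] by simp
qed

end

section \<open>Entries of the signature matrix and of the product of two copies\<close>

lemma ennreal_sum_mult:
  fixes f g :: "'a \<Rightarrow> real"
  assumes "\<And>x. x \<in> A \<Longrightarrow> 0 \<le> f x" "\<And>x. x \<in> A \<Longrightarrow> 0 \<le> g x"
  shows "ennreal (\<Sum>x\<in>A. f x * g x) = (\<Sum>x\<in>A. ennreal (f x) * ennreal (g x))"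
proof -
  have "ennreal (\<Sum>x\<in>A. f x * g x) = (\<Sum>x\<in>A. ennreal (f x * g x))"
    using assms by (intro sum_ennreal[symmetric]) simp
  also have "\<dots> = (\<Sum>x\<in>A. ennreal (f x) * ennreal (g x))"
    using assms by (intro sum.cong refl ennreal_mult)
  finally show ?thesis .
qed

text \<open>This is where the independence of the two copies enters.\<close>

lemma nn_integral_pair_pmf_mult:
  fixes f :: "'a \<Rightarrow> ennreal" and g :: "'b \<Rightarrow> ennreal"
  shows "(\<integral>\<^sup>+ x. f (fst x) * g (snd x) \<partial>measure_pmf (pair_pmf A B)) =
    (\<integral>\<^sup>+ a. f a \<partial>measure_pmf A) * (\<integral>\<^sup>+ b. g b \<partial>measure_pmf B)"
  by (simp add: nn_integral_pair_pmf' nn_integral_cmult nn_integral_multc)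

text \<open>An entry depends on its row alone, so its law is obtained from a marginal of the product
  over all rows.\<close>

lemma map_pmf_signature_matrix_entry:
  assumes "i < dim_row U" "j < dim_row U"
  shows "map_pmf (\<lambda>B. B $$ (i, j)) (signature_matrix U p_term hist sample m) =
    map_pmf (\<lambda>\<phi>. the \<phi> j) (signature U p_term hist sample m i)"
proof -
  have "signature U p_term hist sample m i = map_pmf (\<lambda>\<phi>. \<phi> i)
      (Pi_pmf {..<dim_row U} None (\<lambda>i. signature U p_term hist sample m i))"
    using assms(1) by (simp add: Pi_pmf_component)
  then have "map_pmf (\<lambda>\<phi>. the \<phi> j) (signature U p_term hist sample m i) = map_pmf (\<lambda>\<phi>. the \<phi> j)
      (map_pmf (\<lambda>\<phi>. \<phi> i) (Pi_pmf {..<dim_row U} None (\<lambda>i. signature U p_term hist sample m i)))"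
    by (rule arg_cong)
  then show ?thesis
    using assms by (simp add: signature_matrix_def pmf.map_comp o_def)
qed

lemma set_pmf_signature_matrix_carrier:
  assumes "B \<in> set_pmf (signature_matrix U p_term hist sample m)"
  shows "B \<in> carrier_mat (dim_row U) (dim_row U)"
  using assms by (auto simp: signature_matrix_def)

context graph_sampling
begin

lemma dim_row_U: "dim_row U = N"
  using carrier_U by simp

lemma signature_nonneg:
  assumes "i < N" "\<phi> \<in> set_pmf (signature U p_term hist sample m i)"
  shows "0 \<le> the \<phi> j"
proof -
  obtain f where f: "\<phi> = Some f"
    using assms(2) lossless_signature[of m i] by (cases \<phi>) (auto simp: lossless_iff_set_pmf_None)
  then have "f \<in> set_spmf (signature U p_term hist sample m i)"
    using assms(2) by (simp add: in_set_spmf)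
  then show ?thesis
    using set_walks[OF assms(1), of m] f by (auto simp: signature_def)
qed

lemma signature_matrix_entry_nonneg:
  assumes "i < N" "j < N" "B \<in> set_pmf (signature_matrix U p_term hist sample m)"
  shows "0 \<le> B $$ (i, j)"
proof -
  have "B $$ (i, j) \<in> set_pmf (map_pmf (\<lambda>B. B $$ (i, j)) (signature_matrix U p_term hist sample m))"
    using assms(3) by auto
  also have "\<dots> = (\<lambda>\<phi>. the \<phi> j) ` set_pmf (signature U p_term hist sample m i)"
    using assms(1,2) by (simp only: map_pmf_signature_matrix_entry dim_row_U set_map_pmf)
  finally show ?thesis
    using signature_nonneg[OF assms(1)] by auto
qed

lemma nn_integral_signature_matrix_entry:
  assumes V: "V \<in> carrier_mat N N" "(1\<^sub>m N - U) * V = 1\<^sub>m N" "V * (1\<^sub>m N - U) = 1\<^sub>m N"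
    and bounded: "\<And>k i j. i < N \<Longrightarrow> j < N \<Longrightarrow> \<bar>(U ^\<^sub>m k) $$ (i, j)\<bar> \<le> c"
    and ij: "i < N" "j < N" and m: "1 \<le> m"
  shows "(\<integral>\<^sup>+ B. ennreal (B $$ (i, j)) \<partial>measure_pmf (signature_matrix U p_term hist sample m))
    = ennreal (V $$ (i, j))"
proof -
  have "(\<integral>\<^sup>+ B. ennreal (B $$ (i, j)) \<partial>measure_pmf (signature_matrix U p_term hist sample m))
      = (\<integral>\<^sup>+ x. ennreal x \<partial>measure_pmf (map_pmf (\<lambda>B. B $$ (i, j)) (signature_matrix U p_term hist sample m)))"
    by simp
  also have "\<dots> = (\<integral>\<^sup>+ \<phi>. ennreal (the \<phi> j) \<partial>measure_pmf (signature U p_term hist sample m i))"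
    using ij by (subst map_pmf_signature_matrix_entry) (simp_all add: dim_row_U)
  also have "\<dots> = ennreal ((if i = j then 1 else 0) + (V $$ (i, j) - (if i = j then 1 else 0)))"
  proof (rule nn_integral_signature)
    show "(\<lambda>n. visits j n v) \<longlonglongrightarrow> V $$ (v, j) - (if v = j then 1 else 0)" if "v < N" for v
      using V bounded that ij(2) by (rule visits_tendsto_inverse)
  qed (fact ij m)+
  finally show ?thesis by simp
qed

text \<open>All entries are almost surely nonnegative, so one computation in \<open>ennreal\<close>
  gives both integrability and the value. Each summand pairs an entry of \<open>B\<close> with one
  of \<open>B'\<close>, hence its expectation factors.\<close>

lemma has_bochner_integral_signature_matrix_product:
  assumes V: "V \<in> carrier_mat N N" "(1\<^sub>m N - U) * V = 1\<^sub>m N" "V * (1\<^sub>m N - U) = 1\<^sub>m N"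
    and bounded: "\<And>k i j. i < N \<Longrightarrow> j < N \<Longrightarrow> \<bar>(U ^\<^sub>m k) $$ (i, j)\<bar> \<le> c"
    and ij: "i < N" "j < N" and m: "1 \<le> m"
  defines "\<B> \<equiv> signature_matrix U p_term hist sample m"
  shows "has_bochner_integral (measure_pmf (pair_pmf \<B> \<B>))
    (\<lambda>(B, B'). (B * transpose_mat B') $$ (i, j)) ((V * transpose_mat V) $$ (i, j))"
proof (rule has_bochner_integral_nn_integral)
  \<comment> \<open>The entries of \<open>V\<close> are limits of nonnegative partial sums; this is
    needed to return from \<open>ennreal\<close> to real numbers.\<close>
  have V_nonneg: "0 \<le> V $$ (i, j)" if "i < N" "j < N" for i j
  proof -
    have "(\<lambda>n. visits j n i) \<longlonglongrightarrow> V $$ (i, j) - (if i = j then 1 else 0)"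
      using V bounded that by (rule visits_tendsto_inverse)
    from tendsto_add[OF tendsto_const[of "if i = j then 1 else 0"] this]
    have "(\<lambda>n. (if i = j then 1 else 0) + visits j n i) \<longlonglongrightarrow> V $$ (i, j)"
      by simp
    then show ?thesis
      by (rule LIMSEQ_le_const) (auto simp: visits_nonneg[OF that(1)])
  qed
  have entry: "(B * transpose_mat B') $$ (i, j) = (\<Sum>k<N. B $$ (i, k) * B' $$ (j, k))"
    if "B \<in> carrier_mat N N" "B' \<in> carrier_mat N N" for B B' :: "real mat"
    using that ij index_mult_mat_sum[of B N N "transpose_mat B'" N i j] by simp
  have support: "B \<in> carrier_mat N N \<and> (\<forall>i<N. \<forall>j<N. 0 \<le> B $$ (i, j))" if "B \<in> set_pmf \<B>" for B
    using set_pmf_signature_matrix_carrier[OF that[unfolded \<B>_def]]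
      signature_matrix_entry_nonneg[OF _ _ that[unfolded \<B>_def]]
    by (simp add: dim_row_U)
  show "(\<lambda>(B, B'). (B * transpose_mat B') $$ (i, j)) \<in> borel_measurable (measure_pmf (pair_pmf \<B> \<B>))"
    by simp
  show "AE x in measure_pmf (pair_pmf \<B> \<B>). 0 \<le> (case x of (B, B') \<Rightarrow> (B * transpose_mat B') $$ (i, j))"
    using support ij by (auto simp: AE_measure_pmf_iff entry intro!: sum_nonneg mult_nonneg_nonneg)
  show "0 \<le> (V * transpose_mat V) $$ (i, j)"
    using V(1) ij V_nonneg by (simp only: entry) (auto intro!: sum_nonneg)
  have "(\<integral>\<^sup>+ x. ennreal (case x of (B, B') \<Rightarrow> (B * transpose_mat B') $$ (i, j)) \<partial>measure_pmf (pair_pmf \<B> \<B>))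
      = (\<integral>\<^sup>+ x. (\<Sum>k<N. ennreal (fst x $$ (i, k)) * ennreal (snd x $$ (j, k))) \<partial>measure_pmf (pair_pmf \<B> \<B>))"
  proof (intro nn_integral_cong_AE AE_pmfI)
    fix x assume "x \<in> set_pmf (pair_pmf \<B> \<B>)"
    then have x: "fst x \<in> set_pmf \<B>" "snd x \<in> set_pmf \<B>"
      by auto
    have "ennreal ((fst x * transpose_mat (snd x)) $$ (i, j)) = ennreal (\<Sum>k<N. fst x $$ (i, k) * snd x $$ (j, k))"
      using support[OF x(1)] support[OF x(2)] by (simp only: entry)
    also have "\<dots> = (\<Sum>k<N. ennreal (fst x $$ (i, k)) * ennreal (snd x $$ (j, k)))"
      using support[OF x(1)] support[OF x(2)] ij by (intro ennreal_sum_mult) auto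
    finally show "ennreal (case x of (B, B') \<Rightarrow> (B * transpose_mat B') $$ (i, j))
        = (\<Sum>k<N. ennreal (fst x $$ (i, k)) * ennreal (snd x $$ (j, k)))"
      by (simp only: case_prod_unfold)
  qed
  also have "\<dots> = (\<Sum>k<N. \<integral>\<^sup>+ x. ennreal (fst x $$ (i, k)) * ennreal (snd x $$ (j, k)) \<partial>measure_pmf (pair_pmf \<B> \<B>))"
    by (rule nn_integral_sum) simp
  also have "\<dots> = (\<Sum>k<N. ennreal (V $$ (i, k)) * ennreal (V $$ (j, k)))"
  proof (rule sum.cong, rule refl)
    fix k assume "k \<in> {..<N}"
    then have k: "k < N" by simp
    have "(\<integral>\<^sup>+ B. ennreal (B $$ (l, k)) \<partial>measure_pmf \<B>) = ennreal (V $$ (l, k))" if "l < N" for l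
      unfolding \<B>_def using V bounded that k m by (rule nn_integral_signature_matrix_entry)
    then show "(\<integral>\<^sup>+ x. ennreal (fst x $$ (i, k)) * ennreal (snd x $$ (j, k)) \<partial>measure_pmf (pair_pmf \<B> \<B>))
        = ennreal (V $$ (i, k)) * ennreal (V $$ (j, k))"
      using ij nn_integral_pair_pmf_mult[where f="\<lambda>B. ennreal (B $$ (i, k))" and g="\<lambda>B. ennreal (B $$ (j, k))"
          and A=\<B> and B=\<B>]
      by simp
  qed
  also have "\<dots> = ennreal (\<Sum>k<N. V $$ (i, k) * V $$ (j, k))"
    using ij V_nonneg by (intro ennreal_sum_mult[symmetric]) auto
  also have "\<dots> = ennreal ((V * transpose_mat V) $$ (i, j))"
    using V(1) by (simp only: entry)
  finally show "(\<integral>\<^sup>+ x. ennreal (case x of (B, B') \<Rightarrow> (B * transpose_mat B') $$ (i, j)) \<partial>measure_pmf (pair_pmf \<B> \<B>))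
      = ennreal ((V * transpose_mat V) $$ (i, j))" .
qed

end

section \<open>Symmetry of the inverse and conclusion\<close>

text \<open>Transposing \<open>A * V = 1\<^sub>m n\<close> shows that the transpose of
  \<open>V\<close> is a left inverse of the symmetric \<open>A\<close>, hence equal to
  \<open>V\<close>.\<close>

lemma inverse_symmetric:
  fixes A V :: "'a::comm_semiring_1 mat"
  assumes "A \<in> carrier_mat n n" "V \<in> carrier_mat n n" "transpose_mat A = A"
    and "A * V = 1\<^sub>m n" "V * A = 1\<^sub>m n"
  shows "transpose_mat V = V"
proof -
  have tV: "transpose_mat V \<in> carrier_mat n n"
    using assms(2) by simp
  have "transpose_mat V * A = transpose_mat (A * V)"
    using transpose_mult[OF assms(1,2)] assms(3) by simp
  then have left: "transpose_mat V * A = 1\<^sub>m n"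
    by (simp add: assms(4))
  have "transpose_mat V = transpose_mat V * (A * V)"
    using tV by (simp add: assms(4))
  also have "\<dots> = transpose_mat V * A * V"
    by (rule assoc_mult_mat[symmetric, OF tV assms(1,2)])
  also have "\<dots> = V"
    using assms(2) by (simp add: left)
  finally show ?thesis .
qed

text \<open>The first two conjuncts guard against default values: termination gives meaning to
  \<open>the\<close> in \<open>signature_matrix\<close>, and integrability excludes the conventional
  value 0 of an undefined expectation. The third states invertibility together with the
  identity.\<close>

theorem theorem3p2:
  fixes U :: "real mat" and N m :: nat and p_term :: real
    and hist :: "(nat \<times> nat) list \<Rightarrow> 'h" and sample :: "nat \<Rightarrow> 'h \<Rightarrow> nat pmf"
  defines "\<B> \<equiv> signature_matrix U p_term hist sample m"
  assumes "U \<in> carrier_mat N N"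
    and "transpose_mat U = U"
    and "\<And>i j. i < N \<Longrightarrow> j < N \<Longrightarrow> U $$ (i, j) \<ge> 0"
    and "spectral_radius (map_mat complex_of_real U) < 1"
    and "m \<ge> 1"
    and "0 < p_term" and "p_term < 1"
    and "sampling_strategy U hist sample"
    and "nondegenerate U hist sample"
  shows "(\<forall>i < N. lossless_spmf (signature U p_term hist sample m i)) \<and>
    (\<forall>i < N. \<forall>j < N. integrable (measure_pmf (pair_pmf \<B> \<B>))
       (\<lambda>(B, B'). (B * transpose_mat B') $$ (i, j))) \<and>
    (\<exists>V. mat_inverse (1\<^sub>m N - U) = Some V \<and>
       V ^\<^sub>m 2 = mat N N (\<lambda>(i, j). measure_pmf.expectation (pair_pmf \<B> \<B>)
         (\<lambda>(B, B'). (B * transpose_mat B') $$ (i, j))))"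
proof -
  interpret graph_sampling U N p_term hist sample
    using assms by unfold_locales auto
  obtain V where inv: "mat_inverse (1\<^sub>m N - U) = Some V"
    and V: "V \<in> carrier_mat N N" "(1\<^sub>m N - U) * V = 1\<^sub>m N" "V * (1\<^sub>m N - U) = 1\<^sub>m N"
    using mat_inverse_one_minus[OF assms(2,5)] by blast
  obtain c where bounded: "\<And>k i j. i < N \<Longrightarrow> j < N \<Longrightarrow> \<bar>(U ^\<^sub>m k) $$ (i, j)\<bar> \<le> c"
    using pow_mat_bounded[OF assms(2,5)] by blast
  have A: "1\<^sub>m N - U \<in> carrier_mat N N"
    using assms(2) by (rule minus_carrier_mat)
  have "transpose_mat (1\<^sub>m N - U) = 1\<^sub>m N - U"
    using transpose_minus[OF one_carrier_mat assms(2)] assms(3) by simp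
  then have "transpose_mat V = V"
    by (rule inverse_symmetric[OF A V(1) _ V(2,3)])
  moreover have "V ^\<^sub>m 2 = V * V"
    using V(1) by (simp add: numeral_2_eq_2)
  ultimately have V_square: "V ^\<^sub>m 2 = V * transpose_mat V"
    by simp
  have product: "has_bochner_integral (measure_pmf (pair_pmf \<B> \<B>))
      (\<lambda>(B, B'). (B * transpose_mat B') $$ (i, j)) ((V ^\<^sub>m 2) $$ (i, j))" if "i < N" "j < N" for i j
    unfolding V_square \<B>_def
    using V bounded that assms(6) by (rule has_bochner_integral_signature_matrix_product)
  have "V ^\<^sub>m 2 = mat N N (\<lambda>(i, j). measure_pmf.expectation (pair_pmf \<B> \<B>)
      (\<lambda>(B, B'). (B * transpose_mat B') $$ (i, j)))"
    using V(1) has_bochner_integral_integral_eq[OF product] by (intro eq_matI) auto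
  then show ?thesis
    using lossless_signature product inv by (auto simp: has_bochner_integral_iff)
qed

end
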